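(* Let $E$ be a Hausdorff locally convex topological vector space with continuous dual $E'$ equipped with the weak-$\ast$ topology, and let $(\Omega,\Sigma,P)$ be a complete probability space. Assume that both $E$ and $E'$ are separable and that $E'$ is a Souslin space. Let $X:\Omega\to\mathcal P(E')$ be an Effros measurable multifunction with sequentially compact values. Then $X$ is Borel measurable, i.e., a random set.
   Context: $\mathcal P(S)$ denotes the power set of a topological space $S$ and $\mathcal B(S)$ its Borel $\sigma$-algebra. A multifunction is a map $X:\Omega\to\mathcal P(S)$; it is assumed that $X(\omega)\neq\emptyset$ for (almost) all $\omega\in\Omega$. For $B\subset S$ the upper inverse is $X^-(B)=\{\omega\in\Omega: X(\omega)\cap B\neq\emptyset\}$. $X$ is a random set (equivalently, Borel measurable) if $X^-(B)\in\Sigma$ for every $B\in\mathcal B(S)$. $X$ is Effros measurable if $X^-(B)\in\Sigma$ for every open $B\subset S$. A Polish space is a separable, completely metrizable topological space; a Souslin space is a Hausdorff space which is the continuous image of a Polish space. A set is sequentially compact if every sequence in it has a subsequence converging to a point of the set. *)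

theory Defs
  imports "HOL-Probability.Probability"
begin

section \<open>Locally convex spaces and the weak-* dual\<close>

text \<open>
  The library has no class of topological vector spaces, so the topology is an
  explicit abstract topology on (all of) a real vector space type.
\<close>

definition topological_vector_space :: "'a::real_vector topology \<Rightarrow> bool" where
  "topological_vector_space T \<longleftrightarrow>
     topspace T = UNIV \<and>
     continuous_map (prod_topology T T) T (\<lambda>(x, y). x + y) \<and>
     continuous_map (prod_topology euclideanreal T) T (\<lambda>(c, x). c *\<^sub>R x)"

definition locally_convex_tvs :: "'a::real_vector topology \<Rightarrow> bool" where
  "locally_convex_tvs T \<longleftrightarrow>
     topological_vector_space T \<and> neighbourhood_base_at 0 convex T"

definition continuous_dual :: "'a::real_vector topology \<Rightarrow> ('a \<Rightarrow> real) set" where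
  "continuous_dual T = {\<phi>. linear \<phi> \<and> continuous_map T euclideanreal \<phi>}"

text \<open>
  The coarsest topology on the dual making every evaluation at a point continuous.
\<close>

definition weak_star_topology :: "'a::real_vector topology \<Rightarrow> ('a \<Rightarrow> real) topology" where
  "weak_star_topology T =
     topology_generated_by {{\<phi> \<in> continuous_dual T. \<phi> x \<in> U} | x U. open U}"

lemma topspace_weak_star_topology [simp]:
  "topspace (weak_star_topology T) = continuous_dual T"
proof -
  have "continuous_dual T = {\<phi> \<in> continuous_dual T. \<phi> 0 \<in> UNIV}"
    by simp
  then have "continuous_dual T \<in> {{\<phi> \<in> continuous_dual T. \<phi> x \<in> U} | x U. open U}"
    using open_UNIV by blast
  then show ?thesis
    unfolding weak_star_topology_def topology_generated_by_topspace by blast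
qed

lemma continuous_map_weak_star_eval:
  "continuous_map (weak_star_topology T) euclideanreal (\<lambda>\<phi>. \<phi> x)"
  unfolding continuous_map_def topspace_weak_star_topology
  by (auto simp: weak_star_topology_def intro!: topology_generated_by_Basis)

lemma weak_star_topology_eq_pointwise:
  "weak_star_topology T = subtopology (powertop_real UNIV) (continuous_dual T)"
proof -
  let ?W = "weak_star_topology T" and ?P = "subtopology (powertop_real UNIV) (continuous_dual T)"
  have "continuous_map ?W ?P id"
    using continuous_map_weak_star_eval[of T]
    by (auto simp: continuous_map_in_subtopology continuous_map_componentwise_UNIV)
  moreover have "continuous_map ?P ?W id"
    unfolding weak_star_topology_def
  proof (rule continuous_on_generated_topo)
    fix V assume "V \<in> {{\<phi> \<in> continuous_dual T. \<phi> x \<in> U} | x U. open U}"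
    then obtain x U where V: "V = {\<phi> \<in> continuous_dual T. \<phi> x \<in> U}" and "open U"
      by auto
    have "continuous_map ?P euclideanreal (\<lambda>\<phi>. \<phi> x)"
      by (intro continuous_map_from_subtopology continuous_map_product_projection) simp
    then have "openin ?P {\<phi> \<in> topspace ?P. \<phi> x \<in> U}"
      using \<open>open U\<close> by (intro openin_continuous_map_preimage) auto
    moreover have "id -` V \<inter> topspace ?P = {\<phi> \<in> topspace ?P. \<phi> x \<in> U}"
      by (auto simp: V)
    ultimately show "openin ?P (id -` V \<inter> topspace ?P)"
      by simp
  next
    show "id ` topspace ?P \<subseteq> \<Union> {{\<phi> \<in> continuous_dual T. \<phi> x \<in> U} | x U. open U}"
      using topspace_weak_star_topology[of T]
      unfolding weak_star_topology_def topology_generated_by_topspace by simp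
  qed
  moreover have "topspace ?P = topspace ?W"
    by simp
  ultimately show ?thesis
    unfolding topology_eq using topology_finer_continuous_id by metis
qed


section \<open>Polish and Souslin spaces\<close>

definition Polish_space :: "'a topology \<Rightarrow> bool" where
  "Polish_space X \<longleftrightarrow> separable_space X \<and> completely_metrizable_space X"

text \<open>
  HOL cannot quantify over the type of points of the Polish space inside a definition.
  A Polish space has at most continuum many points, so up to homeomorphism it lives on
  a set of reals (the topology being unrelated to the usual one); lemma
  \<open>Souslin_spaceI\<close> shows that Polish spaces on arbitrary types give nothing more.
\<close>

definition Souslin_space :: "'a topology \<Rightarrow> bool" where
  "Souslin_space X \<longleftrightarrow>
     Hausdorff_space X \<and>
     (\<exists>(Y :: real topology) f.
        Polish_space Y \<and> continuous_map Y X f \<and> f ` topspace Y = topspace X)"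

lemma Polish_space_inj_real:
  assumes "Polish_space (Y :: 'b topology)"
  shows "\<exists>g :: 'b \<Rightarrow> real. inj_on g (topspace Y)"
proof -
  obtain M d where M: "Metric_space M d" and Y: "Y = Metric_space.mtopology M d"
    using assms unfolding Polish_space_def completely_metrizable_space_def by blast
  interpret Metric_space M d by (rule M)
  obtain C where C: "countable C" "C \<subseteq> M" "mtopology closure_of C = M"
    using assms unfolding Polish_space_def separable_space_def Y by auto
  define code :: "'b \<Rightarrow> nat" where "code = to_nat_on C"
  have code: "inj_on code C" unfolding code_def using C(1) by (rule inj_on_to_nat_on)
  define h :: "'b \<Rightarrow> nat set" where
    "h = (\<lambda>x. {prod_encode (code c, k) | c k. c \<in> C \<and> d c x < 1 / real (Suc k)})"
  have mem: "prod_encode (code c, k) \<in> h x \<longleftrightarrow> d c x < 1 / real (Suc k)" if "c \<in> C" for c k x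
    using that code unfolding h_def by (auto dest: inj_onD)
  have "inj_on h M"
  proof (rule inj_onI, rule ccontr)
    fix x y assume xy: "x \<in> M" "y \<in> M" "h x = h y" "x \<noteq> y"
    then have "0 < d x y / 2" by simp
    then obtain k where k: "1 / real (Suc k) < d x y / 2"
      by (rule nat_approx_posE)
    have "x \<in> mtopology closure_of C" using C(3) xy(1) by simp
    then have "\<forall>r>0. \<exists>c\<in>C. c \<in> mball x r"
      unfolding metric_closure_of by simp
    moreover have "1 / real (Suc k) > 0" by simp
    ultimately obtain c where c: "c \<in> C" "c \<in> mball x (1 / real (Suc k))" by blast
    have cM: "c \<in> M" using c(1) C(2) by blast
    have 1: "d c x < 1 / real (Suc k)"
      using c(2) by (simp add: commute)
    then have 2: "d c y < 1 / real (Suc k)"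
      using mem[OF c(1)] xy(3) by blast
    have "d x y \<le> d x c + d c y" using triangle xy cM by blast
    with 1 2 k show False using commute[of x c] by linarith
  qed
  moreover obtain j :: "nat set \<Rightarrow> real" where "inj j"
    using nat_sets_eqpoll_reals by (auto simp: eqpoll_def bij_betw_def)
  ultimately have "inj_on (j \<circ> h) (topspace Y)"
    unfolding Y topspace_mtopology by (intro comp_inj_on) (auto intro: inj_on_subset)
  then show ?thesis by blast
qed

lemma Souslin_spaceI:
  fixes Y :: "'b topology" and X :: "'a topology"
  assumes "Hausdorff_space X" "Polish_space Y" "continuous_map Y X f"
    and "f ` topspace Y = topspace X"
  shows "Souslin_space X"
proof -
  obtain g :: "'b \<Rightarrow> real" where g: "inj_on g (topspace Y)"
    using Polish_space_inj_real[OF assms(2)] by blast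
  define g' where "g' = inv_into (topspace Y) g"
  define Z where "Z = pullback_topology (g ` topspace Y) g' Y"
  have g': "g' (g x) = x" if "x \<in> topspace Y" for x
    unfolding g'_def using g that by simp
  have top: "topspace Z = g ` topspace Y"
    unfolding Z_def topspace_pullback_topology using g' by auto
  have "homeomorphic_maps Z Y g' g"
    unfolding homeomorphic_maps_def
  proof (intro conjI ballI)
    show "continuous_map Z Y g'"
      using continuous_map_pullback[of Y Y id] unfolding Z_def by simp
    show "continuous_map Y Z g"
      unfolding Z_def
    proof (rule continuous_map_pullback')
      show "continuous_map Y Y (g' \<circ> g)"
        by (rule continuous_map_eq[of Y Y id]) (auto simp: g')
    qed auto
  qed (auto simp: top g')
  then have hom: "Z homeomorphic_space Y"
    unfolding homeomorphic_space_def by blast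
  have "Polish_space Z"
    using assms(2) homeomorphic_separable_space[OF hom]
      homeomorphic_completely_metrizable_space[OF hom]
    by (simp add: Polish_space_def)
  moreover have "continuous_map Z X (f \<circ> g')"
    by (rule continuous_map_compose[OF _ assms(3)])
      (use \<open>homeomorphic_maps Z Y g' g\<close> in \<open>simp add: homeomorphic_maps_def\<close>)
  moreover have "(f \<circ> g') ` topspace Z = topspace X"
  proof -
    have "(f \<circ> g') ` topspace Z = f ` ((\<lambda>x. g' (g x)) ` topspace Y)"
      by (simp only: top image_comp o_def)
    also have "(\<lambda>x. g' (g x)) ` topspace Y = (\<lambda>x. x) ` topspace Y"
      using g' by (rule image_cong[OF refl])
    finally show ?thesis
      using assms(4) by simp
  qed
  ultimately show ?thesis
    unfolding Souslin_space_def using assms(1) by blast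
qed


section \<open>Multifunctions\<close>

definition sequentially_compact_in :: "'s topology \<Rightarrow> 's set \<Rightarrow> bool" where
  "sequentially_compact_in S K \<longleftrightarrow>
     K \<subseteq> topspace S \<and>
     (\<forall>\<sigma> :: nat \<Rightarrow> 's. (\<forall>n. \<sigma> n \<in> K) \<longrightarrow>
        (\<exists>l\<in>K. \<exists>r :: nat \<Rightarrow> nat. strict_mono r \<and> limitin S (\<sigma> \<circ> r) l sequentially))"

definition Borel_sets :: "'s topology \<Rightarrow> 's set set" where
  "Borel_sets S = sigma_sets (topspace S) {U. openin S U}"

text \<open>
  Values are required to be nonempty only almost everywhere, the weaker of the two
  usual conventions.
\<close>

definition multifunction :: "'w measure \<Rightarrow> 's topology \<Rightarrow> ('w \<Rightarrow> 's set) \<Rightarrow> bool" where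
  "multifunction M S X \<longleftrightarrow>
     (\<forall>\<omega>\<in>space M. X \<omega> \<subseteq> topspace S) \<and> (AE \<omega> in M. X \<omega> \<noteq> {})"

definition upper_inverse :: "'w measure \<Rightarrow> ('w \<Rightarrow> 's set) \<Rightarrow> 's set \<Rightarrow> 'w set" where
  "upper_inverse M X B = {\<omega> \<in> space M. X \<omega> \<inter> B \<noteq> {}}"

definition Effros_measurable :: "'w measure \<Rightarrow> 's topology \<Rightarrow> ('w \<Rightarrow> 's set) \<Rightarrow> bool" where
  "Effros_measurable M S X \<longleftrightarrow> (\<forall>U. openin S U \<longrightarrow> upper_inverse M X U \<in> sets M)"

definition random_set :: "'w measure \<Rightarrow> 's topology \<Rightarrow> ('w \<Rightarrow> 's set) \<Rightarrow> bool" where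
  "random_set M S X \<longleftrightarrow> (\<forall>B\<in>Borel_sets S. upper_inverse M X B \<in> sets M)"

end

theory Submission
  imports Defs
begin

text \<open>
  Evaluating functionals at a countable dense subset of \<open>E\<close> gives a continuous injection
  \<open>\<Phi>\<close> of the dual into the metrizable space of real sequences. It sends sequentially
  compact sets to compact ones, so \<open>\<omega> \<mapsto> \<Phi> ` X \<omega>\<close> is a compact-valued multifunction \<open>K\<close>
  into a metric space, Effros measurable because \<open>\<Phi>\<close> is continuous, and the upper
  inverse of \<open>B\<close> under \<open>X\<close> is that of \<open>\<Phi> ` B\<close> under \<open>K\<close> because \<open>\<Phi>\<close> is injective.

  Let \<open>B\<close> be Borel in the dual, which is the image of a Polish space \<open>Y\<close> under some continuous
  \<open>f\<close>. The preimage of \<open>B\<close> is Borel in \<open>Y\<close>, hence the projection of a closed set \<open>H\<close> in the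
  product of Baire space with \<open>Y\<close> (\<open>analytic_in_Borel_sets\<close>). So \<open>\<Phi> ` B\<close> is the
  image of a closed subset of a Polish space under a continuous map \<open>g\<close>. Covering \<open>H\<close> by
  countably many small closed pieces, each of these again by smaller ones, and so on, yields closed sets
  \<open>H s\<close> indexed by finite sequences \<open>s\<close>. By completeness, \<open>g ` H\<close> is the union over all
  branches \<open>\<sigma>\<close> of the intersections of the sets \<open>closure (g ` H (\<sigma>|n))\<close>.

  In general a set that meets every member of a decreasing sequence need not meet the
  intersection, but a compact set does if the members are closed. Compactness of the values thus
  lets the upper inverse commute with the intersections along a branch, and the upper inverse of
  \<open>g ` H\<close> arises by the Souslin operation from upper inverses of closed sets
  (\<open>upper_inverse_Polish_image\<close>). The latter are measurable, again by compactness
  (\<open>upper_inverse_closed\<close>), and the Souslin operation, although it takes an uncountable union,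
  preserves the measurable sets of a complete finite measure (\<open>Souslin_operation_in_sets\<close>).
\<close>

section \<open>The Souslin operation and complete measures\<close>

text \<open>
  Let \<open>R s\<close> be the part of the union that comes from the branches extending \<open>s\<close>, and \<open>E s\<close> a
  measurable envelope of it inside \<open>A s\<close>. As \<open>R s\<close> is the union of the \<open>R (s @ [k])\<close>, the sets
  \<open>E (s @ [k])\<close> cover \<open>E s\<close> up to a null set. There are only countably many \<open>s\<close>, so
  outside one null set a point of \<open>E []\<close> can be followed from envelope to envelope along a whole
  branch, and it then belongs to \<open>R []\<close>. Hence \<open>R []\<close> differs from \<open>E []\<close> by a null set.
\<close>

lemma Souslin_operation_in_sets:
  fixes A :: "nat list \<Rightarrow> 'w set"
  assumes "complete_measure M" "finite_measure M"
    and A: "\<And>s. A s \<in> sets M"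
  shows "(\<Union>\<sigma>::nat \<Rightarrow> nat. \<Inter>n. A (map \<sigma> [0..<n])) \<in> sets M"
proof -
  interpret complete_measure M by fact
  interpret finite_measure M by fact
  define R where "R s = (\<Union>\<sigma>\<in>{\<sigma>. map \<sigma> [0..<length s] = s}. \<Inter>n. A (map \<sigma> [0..<n]))"
    for s
  have R_sub: "R s \<subseteq> A s" for s
  proof
    fix w assume "w \<in> R s"
    then obtain \<sigma> where "map \<sigma> [0..<length s] = s" "\<And>n. w \<in> A (map \<sigma> [0..<n])"
      unfolding R_def by blast
    then show "w \<in> A s" by metis
  qed
  have R_step: "R s = (\<Union>k. R (s @ [k]))" for s
    unfolding R_def by auto
  have "\<exists>E. measurable_envelope M (R s) E \<and> E \<subseteq> A s" for s
  proof -
    have "R s \<subseteq> space M" using R_sub[of s] sets.sets_into_space[OF A[of s]] by blast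
    from outer_measure_of_attain[OF this] obtain E where
      E: "E \<in> sets M" "R s \<subseteq> E" "outer_measure_of M (R s) = emeasure M E" by blast
    have sub: "R s \<subseteq> E \<inter> A s" using E R_sub by blast
    have m: "E \<inter> A s \<in> sets M" using E A by blast
    have "emeasure M (E \<inter> A s) \<le> emeasure M E" using E by (intro emeasure_mono) auto
    moreover have "outer_measure_of M (R s) \<le> emeasure M (E \<inter> A s)"
      using outer_measure_of_mono[OF sub, of M] m by simp
    ultimately have "emeasure M (E \<inter> A s) = outer_measure_of M (R s)" using E by simp
    moreover have "emeasure M (E \<inter> A s) < \<infinity>"
      using emeasure_finite[of "E \<inter> A s"] by (simp add: less_top[symmetric])
    ultimately have "measurable_envelope M (R s) (E \<inter> A s)"
      using measurable_envelope_eq2[OF sub m] by blast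
    then show ?thesis by blast
  qed
  then obtain E where env: "\<And>s. measurable_envelope M (R s) (E s)" and EA: "\<And>s. E s \<subseteq> A s"
    by metis
  note ED = measurable_envelopeD(1,2)[OF env]
  define N where "N s = E s - (\<Union>k. E (s @ [k]))" for s
  have N: "N s \<in> null_sets M" for s
  proof -
    have m: "N s \<in> sets M" unfolding N_def using ED(2) by blast
    have "N s \<subseteq> E s - R s" unfolding N_def R_step[of s] using ED(1) by blast
    then show ?thesis using measurable_envelopeD1[OF env m] m by (auto simp: null_sets_def)
  qed
  have "(\<Union>s. N s) \<in> null_sets M"
    using N by (intro null_sets_UN') auto
  moreover have "E [] - R [] \<subseteq> (\<Union>s. N s)"
  proof (rule subsetI, rule ccontr)
    fix w assume w: "w \<in> E [] - R []" and "w \<notin> (\<Union>s. N s)"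
    then have "\<exists>k. w \<in> E s \<longrightarrow> w \<in> E (s @ [k])" for s
      unfolding N_def by blast
    then obtain k where k: "\<And>s. w \<in> E s \<Longrightarrow> w \<in> E (s @ [k s])" by metis
    \<comment> \<open>the branch that \<open>w\<close> follows, as the sequence of its finite initial segments\<close>
    define p where "p = rec_nat [] (\<lambda>_ s. s @ [k s])"
    have p: "p 0 = []" "p (Suc n) = p n @ [k (p n)]" for n by (simp_all add: p_def)
    have "w \<in> E (p n)" for n
      by (induction n) (use w k in \<open>auto simp: p\<close>)
    moreover have "p n = map (\<lambda>i. k (p i)) [0..<n]" for n
      by (induction n) (auto simp: p)
    ultimately have "w \<in> A (map (\<lambda>i. k (p i)) [0..<n])" for n
      using EA by (metis subsetD)
    then have "w \<in> R []" unfolding R_def by auto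
    with w show False by blast
  qed
  ultimately have "E [] - R [] \<in> sets M" by (rule complete[rotated])
  then have "E [] - (E [] - R []) \<in> sets M" using ED(2) by blast
  moreover have "E [] - (E [] - R []) = R []" using ED(1)[of "[]"] by blast
  ultimately show ?thesis by (simp add: R_def)
qed

section \<open>Borel sets as projections of closed sets\<close>

text \<open>
  Describing analytic sets as projections along Baire space, rather than as continuous images,
  keeps every witness inside one fixed product, so that countable unions and intersections of
  analytic sets amount to recoding sequences.
\<close>

definition analytic_in :: "'a topology \<Rightarrow> 'a set \<Rightarrow> bool" where
  "analytic_in Y C \<longleftrightarrow>
     (\<exists>H. closedin (prod_topology (euclidean :: (nat \<Rightarrow> nat) topology) Y) H \<and> C = snd ` H)"

lemma Polish_space_Baire_prod:
  assumes "Polish_space Y"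
  shows "Polish_space (prod_topology (euclidean :: (nat \<Rightarrow> nat) topology) Y)"
proof -
  have "completely_metrizable_space (euclidean :: (nat \<Rightarrow> nat) topology)"
  proof -
    have "(euclidean :: nat topology) = discrete_topology UNIV"
      by (simp add: topology_eq discrete_topology_class.open_discrete)
    then have "completely_metrizable_space (euclidean :: nat topology)"
      by (simp add: completely_metrizable_space_discrete_topology)
    then show ?thesis
      unfolding euclidean_product_topology[symmetric]
      by (simp add: completely_metrizable_space_product_topology)
  qed
  moreover obtain D :: "(nat \<Rightarrow> nat) set" where D: "countable D" "euclidean closure_of D = UNIV"
  proof -
    obtain D :: "(nat \<Rightarrow> nat) set" where D: "countable D" "\<And>X. open X \<Longrightarrow> X \<noteq> {} \<Longrightarrow> \<exists>d\<in>D. d \<in> X"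
      using countable_dense_setE by blast
    have "- closure D = {}"
    proof (rule ccontr)
      assume "- closure D \<noteq> {}"
      then obtain d where "d \<in> D" "d \<in> - closure D"
        using D(2)[of "- closure D"] by auto
      then show False using closure_subset by blast
    qed
    then have "euclidean closure_of D = UNIV" by auto
    with D(1) show thesis by (rule that)
  qed
  moreover obtain C where C: "countable C" "C \<subseteq> topspace Y" "Y closure_of C = topspace Y"
    using assms unfolding Polish_space_def separable_space_def by auto
  moreover have "separable_space (prod_topology (euclidean :: (nat \<Rightarrow> nat) topology) Y)"
    unfolding separable_space_def
    using C D by (intro exI[of _ "D \<times> C"]) (auto simp: closure_of_Times)
  ultimately show ?thesis
    using assms by (simp add: Polish_space_def completely_metrizable_space_prod_topology)
qed

lemma continuous_map_reindex:
  fixes h :: "nat \<Rightarrow> nat"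
  shows "continuous_map (prod_topology (euclidean :: (nat \<Rightarrow> nat) topology) Y)
    (prod_topology euclidean Y) (\<lambda>p. (fst p \<circ> h, snd p))"
proof -
  have "continuous_on UNIV (\<lambda>\<sigma> :: nat \<Rightarrow> nat. \<sigma> \<circ> h)"
    by (intro continuous_on_coordinatewise_then_product) (simp add: continuous_on_product_coordinates)
  then have "continuous_map euclidean euclidean (\<lambda>\<sigma> :: nat \<Rightarrow> nat. \<sigma> \<circ> h)" by simp
  from continuous_map_compose[OF continuous_map_fst this]
  show ?thesis
    by (simp add: continuous_map_pairwise o_def continuous_map_snd)
qed

lemma closedin_reindex:
  assumes "closedin (prod_topology (euclidean :: (nat \<Rightarrow> nat) topology) Y) H"
  shows "closedin (prod_topology (euclidean :: (nat \<Rightarrow> nat) topology) Y)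
    {p \<in> UNIV \<times> topspace Y. (fst p \<circ> h, snd p) \<in> H}"
  using closedin_continuous_map_preimage[OF continuous_map_reindex assms] by simp

lemma analytic_in_closedin:
  assumes "closedin Y C"
  shows "analytic_in Y C"
  unfolding analytic_in_def
  by (rule exI[of _ "UNIV \<times> C"]) (use assms in \<open>auto simp: closedin_prod_Times_iff\<close>)

text \<open>
  The first entry of the sequence tells which of the sets is meant, the remaining ones form a
  witness for it. The resulting relation is closed because the first entry is locally constant.
\<close>

lemma analytic_in_UN:
  assumes "\<And>n::nat. analytic_in Y (C n)"
  shows "analytic_in Y (\<Union>n. C n)"
proof -
  let ?P = "prod_topology (euclidean :: (nat \<Rightarrow> nat) topology) Y"
  obtain H where H: "\<And>n. closedin ?P (H n)" "\<And>n. C n = snd ` H n"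
    using assms unfolding analytic_in_def by metis
  have HY: "H n \<subseteq> UNIV \<times> topspace Y" for n
    using closedin_subset[OF H(1)[of n]] by simp
  \<comment> \<open>\<open>(\<sigma> \<circ> Suc, y) \<in> H (\<sigma> 0)\<close>, written as an implication for every possible value of \<open>\<sigma> 0\<close>
      so that it is visibly an intersection of closed conditions\<close>
  define G where "G = (\<Inter>n. {p \<in> UNIV \<times> topspace Y. fst p 0 \<in> - {n}} \<union>
      {p \<in> UNIV \<times> topspace Y. (fst p \<circ> Suc, snd p) \<in> H n})"
  have "continuous_map ?P euclidean (\<lambda>p. fst p 0)"
  proof -
    have "continuous_map euclidean euclidean (\<lambda>\<sigma> :: nat \<Rightarrow> nat. \<sigma> 0)"
      by (simp add: continuous_on_product_coordinates)
    from continuous_map_compose[OF continuous_map_fst this] show ?thesis by (simp add: o_def)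
  qed
  moreover have "closedin euclidean (- {n} :: nat set)" for n by (simp add: closed_def discrete_topology_class.open_discrete)
  ultimately have "closedin ?P {p \<in> UNIV \<times> topspace Y. fst p 0 \<in> - {n}}" for n
    using closedin_continuous_map_preimage by fastforce
  then have "closedin ?P G"
    unfolding G_def by (intro closedin_INT closedin_Un closedin_reindex H) auto
  moreover have "(\<Union>n. C n) = snd ` G"
  proof (intro equalityI subsetI)
    fix y assume "y \<in> (\<Union>n. C n)"
    then obtain n \<sigma> where n: "(\<sigma>, y) \<in> H n" using H(2) by auto
    then have "(case_nat n \<sigma>, y) \<in> G"
      using HY[of n] unfolding G_def by (auto simp: o_def)
    then show "y \<in> snd ` G" by force
  qed (use H(2) in \<open>force simp: G_def\<close>)
  ultimately show ?thesis unfolding analytic_in_def by blast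
qed

text \<open>
  One sequence can carry witnesses for all the sets at once, the one for \<open>C n\<close> being stored at the
  positions \<open>prod_encode (n, k)\<close>.
\<close>

lemma analytic_in_INT:
  assumes "\<And>n::nat. analytic_in Y (C n)"
  shows "analytic_in Y (\<Inter>n. C n)"
proof -
  let ?P = "prod_topology (euclidean :: (nat \<Rightarrow> nat) topology) Y"
  obtain H where H: "\<And>n. closedin ?P (H n)" "\<And>n. C n = snd ` H n"
    using assms unfolding analytic_in_def by metis
  have HY: "H n \<subseteq> UNIV \<times> topspace Y" for n
    using closedin_subset[OF H(1)[of n]] by simp
  define G where "G = (\<Inter>n. {p \<in> UNIV \<times> topspace Y.
      (fst p \<circ> (\<lambda>k. prod_encode (n, k)), snd p) \<in> H n})"
  have "closedin ?P G"
    unfolding G_def by (intro closedin_INT closedin_reindex H) auto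
  moreover have "(\<Inter>n. C n) = snd ` G"
  proof (intro equalityI subsetI)
    fix y assume "y \<in> (\<Inter>n. C n)"
    then have "y \<in> snd ` H n" for n using H(2) by blast
    then have "\<exists>\<tau>. (\<tau>, y) \<in> H n" for n by force
    then obtain \<tau> where t: "\<And>n. (\<tau> n, y) \<in> H n" by metis
    define \<sigma> where "\<sigma> = (\<lambda>m. case prod_decode m of (n, k) \<Rightarrow> \<tau> n k)"
    have "\<sigma> \<circ> (\<lambda>k. prod_encode (n, k)) = \<tau> n" for n by (auto simp: \<sigma>_def)
    then have "(\<sigma>, y) \<in> G" unfolding G_def using t HY[of 0] by auto
    then show "y \<in> snd ` G" by force
  qed (use H(2) in \<open>force simp: G_def\<close>)
  ultimately show ?thesis unfolding analytic_in_def by blast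
qed

lemma analytic_in_openin:
  assumes "metrizable_space Y" "openin Y U"
  shows "analytic_in Y U"
proof -
  obtain F :: "nat \<Rightarrow> _" where "\<And>n. closedin Y (F n)" "\<Union> (range F) = U"
    using open_imp_fsigma_in[OF assms] unfolding fsigma_in_ascending by blast
  then show ?thesis
    using analytic_in_UN[of Y F] by (auto intro: analytic_in_closedin)
qed

text \<open>
  Complements of analytic sets are in general not analytic, so the induction carries a set
  together with its complement. Metrizability enters through the open sets, which have to be
  countable unions of closed ones.
\<close>

lemma analytic_in_Borel_sets:
  assumes "metrizable_space Y" "C \<in> Borel_sets Y"
  shows "analytic_in Y C"
proof -
  have "analytic_in Y C \<and> analytic_in Y (topspace Y - C)"
    using assms(2) unfolding Borel_sets_def
  proof (induction rule: sigma_sets.induct)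
    case (Basic U)
    then show ?case
      using analytic_in_openin[OF assms(1)] by (auto intro!: analytic_in_closedin)
  next
    case Empty
    then show ?case by (auto intro: analytic_in_closedin)
  next
    case (Compl C)
    then have "C \<subseteq> topspace Y"
      using sigma_sets_into_sp[of "{U. openin Y U}" "topspace Y"] by (auto dest: openin_subset)
    with Compl show ?case by (simp add: double_diff)
  next
    case (Union C)
    have "topspace Y - (\<Union>n. C n) = (\<Inter>n. topspace Y - C n)" by auto
    with Union show ?case using analytic_in_UN[of Y C] analytic_in_INT[of Y "\<lambda>n. topspace Y - C n"]
      by simp
  qed
  then show ?thesis ..
qed

lemma Borel_sets_continuous_preimage:
  assumes "continuous_map Y S f" "B \<in> Borel_sets S"
  shows "{y \<in> topspace Y. f y \<in> B} \<in> Borel_sets Y"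
  using assms(2) unfolding Borel_sets_def
proof (induction rule: sigma_sets.induct)
  case (Basic U)
  then show ?case
    using openin_continuous_map_preimage[OF assms(1)] by (auto intro: sigma_sets.Basic)
next
  case Empty
  then show ?case by (simp add: sigma_sets.Empty)
next
  case (Compl B)
  have "{y \<in> topspace Y. f y \<in> topspace S - B} = topspace Y - {y \<in> topspace Y. f y \<in> B}"
    using continuous_map_image_subset_topspace[OF assms(1)] by auto
  with Compl show ?case by (metis (no_types, lifting) sigma_sets.Compl)
next
  case (Union B)
  have "{y \<in> topspace Y. f y \<in> (\<Union>n. B n)} = (\<Union>n. {y \<in> topspace Y. f y \<in> B n})" by auto
  with Union show ?case by (metis (no_types, lifting) sigma_sets.Union)
qed

section \<open>Upper inverses of compact-valued multifunctions\<close>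

lemma compact_meets_INT:
  fixes F :: "nat \<Rightarrow> 'b::metric_space set"
  assumes "compact K" "\<And>n. closed (F n)" "decseq F" "\<And>n. K \<inter> F n \<noteq> {}"
  shows "K \<inter> (\<Inter>n. F n) \<noteq> {}"
proof (rule compact_imp_fip_image[OF assms(1)])
  fix I :: "nat set" assume "finite I"
  then obtain m where "\<And>n. n \<in> I \<Longrightarrow> n \<le> m" by (meson finite_nat_set_iff_bounded_le)
  then have "F m \<subseteq> (\<Inter>n\<in>I. F n)" using decseqD[OF assms(3)] by blast
  then show "K \<inter> (\<Inter>n\<in>I. F n) \<noteq> {}" using assms(4)[of m] by blast
qed (use assms in auto)

text \<open>
  A compact set that meets every open neighbourhood \<open>{x. infdist x F < 1 / (k + 1)}\<close> of the closed
  set \<open>F\<close> meets \<open>F\<close>: it meets the larger closed sets \<open>C k\<close>, which decrease to \<open>F\<close>.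
\<close>

lemma upper_inverse_closed:
  fixes K :: "'w \<Rightarrow> 'b::metric_space set"
  assumes "\<And>\<omega>. \<omega> \<in> space M \<Longrightarrow> compact (K \<omega>)"
    and "\<And>U. open U \<Longrightarrow> upper_inverse M K U \<in> sets M"
    and "closed F"
  shows "upper_inverse M K F \<in> sets M"
proof (cases "F = {}")
  case True
  then show ?thesis by (simp add: upper_inverse_def)
next
  case False
  define U where "U k = {x. infdist x F < 1 / real (Suc k)}" for k
  define C where "C k = {x. infdist x F \<le> 1 / real (Suc k)}" for k
  have "upper_inverse M K F = (\<Inter>k. upper_inverse M K (U k))"
  proof (intro equalityI subsetI)
    fix \<omega> assume "\<omega> \<in> upper_inverse M K F"
    then show "\<omega> \<in> (\<Inter>k. upper_inverse M K (U k))"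
      unfolding upper_inverse_def U_def by fastforce
  next
    fix \<omega> assume \<omega>: "\<omega> \<in> (\<Inter>k. upper_inverse M K (U k))"
    then have sp: "\<omega> \<in> space M" by (auto simp: upper_inverse_def)
    have "K \<omega> \<inter> C k \<noteq> {}" for k
    proof -
      have "\<omega> \<in> upper_inverse M K (U k)" using \<omega> by blast
      moreover have "U k \<subseteq> C k" by (auto simp: U_def C_def)
      ultimately show ?thesis unfolding upper_inverse_def by blast
    qed
    moreover have "closed (C k)" for k
      unfolding C_def by (intro closed_Collect_le continuous_intros)
    moreover have "decseq C"
      by (rule decseq_SucI) (auto simp: C_def intro: order_trans[OF _ frac_le])
    ultimately obtain x where x: "x \<in> K \<omega>" "\<And>k. infdist x F \<le> 1 / real (Suc k)"
      using compact_meets_INT[OF assms(1)[OF sp], of C] unfolding C_def by blast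
    have "infdist x F \<le> 0"
      by (rule LIMSEQ_le_const[OF LIMSEQ_inverse_real_of_nat])
        (use x(2) in \<open>auto simp: inverse_eq_divide\<close>)
    then have "x \<in> F"
      using in_closed_iff_infdist_zero[OF assms(3) False] infdist_nonneg[of x F] by simp
    with sp x(1) show "\<omega> \<in> upper_inverse M K F" by (auto simp: upper_inverse_def)
  qed
  moreover have "open (U k)" for k
    unfolding U_def by (intro open_Collect_less continuous_intros)
  ultimately show ?thesis using assms(2) by auto
qed

text \<open>
  The space is covered at every scale by balls around a dense sequence \<open>c\<close>, and \<open>B s\<close> is the part
  of \<open>H\<close> in the balls of radius \<open>1, 1/2, 1/3, \<dots>\<close> around the centres numbered by \<open>s\<close>. Along a
  branch whose closures all meet the compact set \<open>K \<omega>\<close> there is a common point \<open>x\<close> of \<open>K \<omega>\<close> and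
  these closures, while by completeness the pieces themselves shrink to a point \<open>z\<close> of \<open>H\<close>.
  Continuity of \<open>g\<close> at \<open>z\<close> forces \<open>x = g z\<close>, so passing to closures in the image does not
  enlarge the set.
\<close>

lemma upper_inverse_Polish_image:
  fixes K :: "'w \<Rightarrow> 'b::metric_space set" and Z :: "'z topology"
  assumes "complete_measure M" "finite_measure M"
    and K: "\<And>\<omega>. \<omega> \<in> space M \<Longrightarrow> compact (K \<omega>)"
    and op: "\<And>U. open U \<Longrightarrow> upper_inverse M K U \<in> sets M"
    and Z: "Polish_space Z" and g: "continuous_map Z euclidean g" and H: "closedin Z H"
  shows "upper_inverse M K (g ` H) \<in> sets M"
proof (cases "H = {}")
  case True
  then show ?thesis by (simp add: upper_inverse_def)
next
  case False
  obtain P d where "Metric_space P d" and complete: "Metric_space.mcomplete P d"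
    and Zd: "Z = Metric_space.mtopology P d"
    using Z unfolding Polish_space_def completely_metrizable_space_def by blast
  interpret Metric_space P d by fact
  obtain D where D: "countable D" "D \<subseteq> P" "mtopology closure_of D = P"
    using Z unfolding Polish_space_def separable_space_def Zd by auto
  have HP: "H \<subseteq> P" using closedin_subset[OF H] by (simp add: Zd)
  have "D \<noteq> {}" using D(3) HP False by auto
  define c where "c = from_nat_into D"
  have cP: "c i \<in> P" for i using from_nat_into[OF \<open>D \<noteq> {}\<close>] D(2) by (auto simp: c_def)
  have c_dense: "\<exists>i. z \<in> mcball (c i) r" if "z \<in> P" "r > 0" for z r
  proof -
    have "z \<in> mtopology closure_of D" using that D(3) by simp
    then obtain x where "x \<in> D" "x \<in> mball z r"
      using \<open>r > 0\<close> unfolding metric_closure_of by blast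
    moreover from \<open>x \<in> D\<close> obtain i where "c i = x"
      using from_nat_into_surj[OF D(1) \<open>x \<in> D\<close>] by (auto simp: c_def)
    ultimately show ?thesis by (auto simp: commute intro!: exI[of _ i])
  qed
  define B where "B s = H \<inter> (\<Inter>i<length s. mcball (c (s ! i)) (1 / real (Suc i)))" for s
  have B_prefix: "B (map \<sigma> [0..<n]) = H \<inter> (\<Inter>i<n. mcball (c (\<sigma> i)) (1 / real (Suc i)))"
    for \<sigma> n by (simp add: B_def)
  have B_closed: "closedin mtopology (B s)" for s
    using H by (cases "length s = 0") (auto simp: B_def Zd intro!: closedin_Int closedin_INT)
  let ?F = "\<lambda>\<sigma> n. closure (g ` B (map \<sigma> [0..<n]))"
  have "upper_inverse M K (g ` H) =
      (\<Union>\<sigma>. \<Inter>n. upper_inverse M K (?F \<sigma> n))" (is "?L = ?R")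
  proof (intro equalityI subsetI)
    fix \<omega> assume "\<omega> \<in> ?L"
    then obtain z where z: "\<omega> \<in> space M" "z \<in> H" "g z \<in> K \<omega>"
      by (auto simp: upper_inverse_def)
    have "\<forall>i. \<exists>k. z \<in> mcball (c k) (1 / real (Suc i))" using z(2) HP c_dense[of z] by (auto simp del: in_mcball)
    then obtain \<sigma> where "\<And>i. z \<in> mcball (c (\<sigma> i)) (1 / real (Suc i))" by metis
    then have "z \<in> B (map \<sigma> [0..<n])" for n using z(2) unfolding B_prefix by blast
    then have "g z \<in> ?F \<sigma> n" for n using closure_subset by blast
    then show "\<omega> \<in> ?R" using z by (auto simp: upper_inverse_def)
  next
    fix \<omega> assume "\<omega> \<in> ?R"
    then obtain \<sigma> where sp: "\<omega> \<in> space M" and ne: "\<And>n. K \<omega> \<inter> ?F \<sigma> n \<noteq> {}"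
      by (auto simp: upper_inverse_def)
    let ?B = "\<lambda>n. B (map \<sigma> [0..<n])"
    have dec: "?B n \<subseteq> ?B m" if "m \<le> n" for m n
      using that unfolding B_prefix by (auto; meson less_le_trans)
    have "decseq (?F \<sigma>)"
      unfolding decseq_def by (intro allI impI closure_mono image_mono dec)
    from compact_meets_INT[OF K[OF sp] _ this ne]
    obtain x where x: "x \<in> K \<omega>" "\<And>n. x \<in> ?F \<sigma> n" by auto
    have Bne: "?B n \<noteq> {}" for n using ne[of n] by auto
    have Bd: "d y z \<le> 2 / real (Suc n)" if "y \<in> ?B (Suc n)" "z \<in> ?B (Suc n)" for y z n
    proof -
      have "y \<in> mcball (c (\<sigma> n)) (1 / real (Suc n))" "z \<in> mcball (c (\<sigma> n)) (1 / real (Suc n))"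
        using that unfolding B_prefix by auto
      then have 1: "y \<in> P" "z \<in> P" "d (c (\<sigma> n)) y \<le> 1 / real (Suc n)" "d (c (\<sigma> n)) z \<le> 1 / real (Suc n)"
        by auto
      have "d y z \<le> d y (c (\<sigma> n)) + d (c (\<sigma> n)) z" using 1 cP by (intro triangle) auto
      then show ?thesis using 1 by (simp add: commute)
    qed
    have small: "\<exists>n. 2 / real (Suc n) < \<epsilon>" if "\<epsilon> > 0" for \<epsilon>
    proof -
      obtain n where "1 / real (Suc n) < \<epsilon> / 2"
        using \<open>\<epsilon> > 0\<close> by (metis half_gt_zero nat_approx_posE)
      then show ?thesis by (intro exI[of _ n]) simp
    qed
    have "\<Inter> (range ?B) \<noteq> {}"
    proof (rule mcomplete_nest[THEN iffD1, OF complete, rule_format])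
      show "(\<forall>n. closedin mtopology (?B n)) \<and> (\<forall>n. ?B n \<noteq> {}) \<and> decseq ?B \<and>
          (\<forall>\<epsilon>>0. \<exists>n a. ?B n \<subseteq> mcball a \<epsilon>)"
      proof (intro conjI allI impI B_closed Bne)
        show "decseq ?B" unfolding decseq_def using dec by blast
        fix \<epsilon> :: real assume "\<epsilon> > 0"
        then obtain n where n: "2 / real (Suc n) < \<epsilon>" using small by blast
        obtain a where a: "a \<in> ?B (Suc n)" using Bne by blast
        have "?B (Suc n) \<subseteq> mcball a \<epsilon>"
        proof
          fix y assume y: "y \<in> ?B (Suc n)"
          have "a \<in> P" "y \<in> P" using a y HP by (auto simp: B_def)
          with Bd[OF a y] n show "y \<in> mcball a \<epsilon>" by simp
        qed
        then show "\<exists>n a. ?B n \<subseteq> mcball a \<epsilon>" by blast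
      qed
    qed
    then obtain z where z: "\<And>n. z \<in> ?B n" by auto
    then have zH: "z \<in> H" by (auto simp: B_def)
    then have zP: "z \<in> P" using HP by blast
    have "x = g z"
    proof (rule ccontr)
      assume "x \<noteq> g z"
      \<comment> \<open>some piece has its image, and hence the closure of it, within half the distance of \<open>g z\<close>\<close>
      define \<epsilon> where "\<epsilon> = dist (g z) x / 2"
      have "\<epsilon> > 0" using \<open>x \<noteq> g z\<close> by (simp add: \<epsilon>_def)
      have "openin mtopology {y \<in> P. g y \<in> ball (g z) \<epsilon>}"
        using openin_continuous_map_preimage[OF g, of "ball (g z) \<epsilon>"] by (simp add: Zd)
      moreover have "z \<in> {y \<in> P. g y \<in> ball (g z) \<epsilon>}" using zP \<open>\<epsilon> > 0\<close> by simp
      ultimately obtain r where r: "r > 0" "mball z r \<subseteq> {y \<in> P. g y \<in> ball (g z) \<epsilon>}"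
        unfolding openin_mtopology by blast
      obtain n where n: "2 / real (Suc n) < r" using small r(1) by blast
      have "g ` ?B (Suc n) \<subseteq> cball (g z) \<epsilon>"
      proof
        fix v assume "v \<in> g ` ?B (Suc n)"
        then obtain y where y: "y \<in> ?B (Suc n)" "v = g y" by blast
        have "y \<in> P" using y HP by (auto simp: B_def)
        then have "y \<in> mball z r" using Bd[OF z y(1)] n zP by simp
        with r(2) y show "v \<in> cball (g z) \<epsilon>" by force
      qed
      then have "?F \<sigma> (Suc n) \<subseteq> cball (g z) \<epsilon>" by (intro closure_minimal) auto
      then have "dist (g z) x \<le> \<epsilon>" using x(2)[of "Suc n"] by auto
      with \<open>\<epsilon> > 0\<close> show False by (simp add: \<epsilon>_def)
    qed
    with x zH sp show "\<omega> \<in> ?L" by (auto simp: upper_inverse_def)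
  qed
  moreover have "?R \<in> sets M"
    using Souslin_operation_in_sets[OF assms(1,2), of "\<lambda>s. upper_inverse M K (closure (g ` B s))"]
      upper_inverse_closed[OF K op] by simp
  ultimately show ?thesis by simp
qed

section \<open>Random sets in Souslin spaces\<close>

text \<open>
  The functions \<open>u n\<close> are the coordinates of a continuous injection \<open>\<Phi>\<close> into the metrizable space
  of real sequences, where the images of the sequentially compact values are compact. The
  image of a Borel set of \<open>S\<close> is analytic there because \<open>S\<close> is a Souslin space.
\<close>

lemma random_set_of_separating_functions:
  fixes u :: "nat \<Rightarrow> 's \<Rightarrow> real"
  assumes "complete_measure M" "finite_measure M" and S: "Souslin_space S"
    and u: "\<And>n. continuous_map S euclideanreal (u n)"
    and sep: "\<And>x y. \<lbrakk>x \<in> topspace S; y \<in> topspace S; \<And>n. u n x = u n y\<rbrakk> \<Longrightarrow> x = y"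
    and "Effros_measurable M S X"
    and X: "\<And>\<omega>. \<omega> \<in> space M \<Longrightarrow> sequentially_compact_in S (X \<omega>)"
  shows "random_set M S X"
proof -
  define \<Phi> where "\<Phi> = (\<lambda>x n. u n x)"
  have cont: "continuous_map S euclidean \<Phi>"
    using u by (simp add: \<Phi>_def continuous_map_componentwise_UNIV flip: euclidean_product_topology)
  have inj: "inj_on \<Phi> (topspace S)"
    using sep by (auto simp: inj_on_def \<Phi>_def fun_eq_iff)
  have X_sub: "X \<omega> \<subseteq> topspace S" if "\<omega> \<in> space M" for \<omega>
    using X[OF that] by (simp add: sequentially_compact_in_def)
  define K where "K \<omega> = \<Phi> ` X \<omega>" for \<omega>
  have K: "compact (K \<omega>)" if \<omega>: "\<omega> \<in> space M" for \<omega>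
    unfolding seq_compact_eq_compact[symmetric]
  proof (rule seq_compactI)
    fix s :: "nat \<Rightarrow> nat \<Rightarrow> real" assume "\<forall>n. s n \<in> K \<omega>"
    then have "\<forall>n. \<exists>x \<in> X \<omega>. s n = \<Phi> x" by (auto simp: K_def)
    then obtain \<sigma> :: "nat \<Rightarrow> 's" where \<sigma>: "\<And>n. \<sigma> n \<in> X \<omega>" "\<And>n. s n = \<Phi> (\<sigma> n)" by metis
    then obtain l and r :: "nat \<Rightarrow> nat" where l: "l \<in> X \<omega>" "strict_mono r" "limitin S (\<sigma> \<circ> r) l sequentially"
      using X[OF \<omega>] unfolding sequentially_compact_in_def by blast
    have "limitin euclidean (\<Phi> \<circ> (\<sigma> \<circ> r)) (\<Phi> l) sequentially"
      using continuous_map_limit[OF cont l(3)] .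
    moreover have "\<Phi> \<circ> (\<sigma> \<circ> r) = s \<circ> r" by (simp add: fun_eq_iff \<sigma>(2))
    ultimately show "\<exists>l\<in>K \<omega>. \<exists>r. strict_mono r \<and> (s \<circ> r) \<longlonglongrightarrow> l"
      using l by (auto simp: K_def)
  qed
  have op: "upper_inverse M K U \<in> sets M" if "open U" for U
  proof -
    have "upper_inverse M K U = upper_inverse M X {x \<in> topspace S. \<Phi> x \<in> U}"
      using X_sub unfolding upper_inverse_def K_def by fastforce
    moreover have "openin S {x \<in> topspace S. \<Phi> x \<in> U}"
      using openin_continuous_map_preimage[OF cont] that by simp
    ultimately show ?thesis
      using assms(6) by (simp add: Effros_measurable_def)
  qed
  obtain Y :: "real topology" and f where Y: "Polish_space Y"
    and f: "continuous_map Y S f" "f ` topspace Y = topspace S"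
    using S unfolding Souslin_space_def by blast
  have "metrizable_space Y"
    using Y by (simp add: Polish_space_def completely_metrizable_imp_metrizable_space)
  show ?thesis
    unfolding random_set_def
  proof
    fix B assume B: "B \<in> Borel_sets S"
    have BS: "B \<subseteq> topspace S"
      using B sigma_sets_into_sp[of "{U. openin S U}" "topspace S"]
      unfolding Borel_sets_def by (auto dest: openin_subset)
    have "analytic_in Y {y \<in> topspace Y. f y \<in> B}"
      using \<open>metrizable_space Y\<close> Borel_sets_continuous_preimage[OF f(1) B]
      by (rule analytic_in_Borel_sets)
    then obtain H where
      H: "closedin (prod_topology (euclidean :: (nat \<Rightarrow> nat) topology) Y) H"
        "{y \<in> topspace Y. f y \<in> B} = snd ` H"
      unfolding analytic_in_def by blast
    have "continuous_map (prod_topology (euclidean :: (nat \<Rightarrow> nat) topology) Y) euclidean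
        (\<Phi> \<circ> (f \<circ> snd))"
      by (intro continuous_map_compose[OF _ cont] continuous_map_compose[OF continuous_map_snd f(1)])
    from upper_inverse_Polish_image[OF assms(1,2) K op Polish_space_Baire_prod[OF Y] this H(1)]
    have "upper_inverse M K ((\<Phi> \<circ> (f \<circ> snd)) ` H) \<in> sets M" by blast
    moreover have "(\<Phi> \<circ> (f \<circ> snd)) ` H = \<Phi> ` B"
    proof -
      have "f ` snd ` H = B" using H(2)[symmetric] f(2) BS by auto
      then show ?thesis by (simp only: image_comp[symmetric])
    qed
    moreover have "upper_inverse M K (\<Phi> ` B) = upper_inverse M X B"
    proof -
      have "\<Phi> ` X \<omega> \<inter> \<Phi> ` B = \<Phi> ` (X \<omega> \<inter> B)" if "\<omega> \<in> space M" for \<omega>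
        using inj_on_image_Int[OF inj X_sub[OF that] BS] by simp
      then show ?thesis by (auto simp: upper_inverse_def K_def)
    qed
    ultimately show "upper_inverse M X B \<in> sets M" by simp
  qed
qed

theorem theorem2p2:
  fixes T :: "'a::real_vector topology"
    and M :: "'w measure"
    and X :: "'w \<Rightarrow> ('a \<Rightarrow> real) set"
  assumes "Hausdorff_space T" and "locally_convex_tvs T"
    and "prob_space M" and "complete_measure M"
    and "separable_space T"
    and "separable_space (weak_star_topology T)"
    and "Souslin_space (weak_star_topology T)"
    and "multifunction M (weak_star_topology T) X"
    and "Effros_measurable M (weak_star_topology T) X"
    and "\<And>\<omega>. \<omega> \<in> space M \<Longrightarrow> sequentially_compact_in (weak_star_topology T) (X \<omega>)"
  shows "random_set M (weak_star_topology T) X"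
proof -
  have top: "topspace T = UNIV"
    using assms(2) by (simp add: locally_convex_tvs_def topological_vector_space_def)
  obtain D where D: "countable D" "T closure_of D = UNIV"
    using assms(5) unfolding separable_space_def top by blast
  have "D \<noteq> {}" using D(2) by auto
  show ?thesis
  proof (rule random_set_of_separating_functions[OF assms(4) _ assms(7) _ _ assms(9,10)])
    show "finite_measure M" using assms(3) by (simp add: prob_space_def)
    show "continuous_map (weak_star_topology T) euclideanreal (\<lambda>\<phi>. \<phi> (from_nat_into D n))" for n
      by (rule continuous_map_weak_star_eval)
    fix \<phi> \<psi> assume \<phi>\<psi>: "\<phi> \<in> topspace (weak_star_topology T)" "\<psi> \<in> topspace (weak_star_topology T)"
      and eq: "\<And>n. \<phi> (from_nat_into D n) = \<psi> (from_nat_into D n)"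
    have cont: "continuous_map T euclideanreal \<phi>" "continuous_map T euclideanreal \<psi>"
      using \<phi>\<psi> by (auto simp: continuous_dual_def)
    \<comment> \<open>the values on \<open>D\<close> determine a continuous functional\<close>
    have "\<phi> y = \<psi> y" if "y \<in> D" for y
      using eq from_nat_into_surj[OF D(1) that] by metis
    then have "\<phi> x = \<psi> x" for x
      using forall_in_closure_of_eq[OF _ _ cont, of x D] D(2) by simp
    then show "\<phi> = \<psi>" by blast
  qed
qed

end
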